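(* Let $S\subseteq \mathbb{N}_0^d$ be a generalized numerical semigroup with corner element $\mathbf{c}$. Then $S$ is an atom (of $\mathcal{F}(\mathbf{c})$) if and only if $|\operatorname{CEH}(S)| \leq 1$.
   Context: $\mathbb{N}_0$ is the set of non-negative integers and $d\ge 1$ is an integer. A generalized numerical semigroup (GNS) in $\mathbb{N}_0^d$ is a subset $S\subseteq\mathbb{N}_0^d$ closed under addition, containing $\mathbf{0}$, with finite complement $\operatorname{H}(S)=\mathbb{N}_0^d\setminus S$ (the gaps of $S$). Put $S^*=S\setminus\{\mathbf{0}\}$. Corner element: the corner element of a GNS $S$ is the unique $\mathbf{c}=(c_1,\dots,c_d)\in S$ such that (1) for all $i$ and all $x\in\mathbb{N}_0$ with $x\ge c_i$, every vector of $\mathbb{N}_0^d$ with $i$-th coordinate $x$ lies in $S$; (2) for all $i$, there are $z_j\in\mathbb{N}_0$ ($j\neq i$) such that $(z_1,\dots,z_{i-1},c_i-1,z_{i+1},\dots,z_d)\notin S$. (If $\operatorname{H}(S)\ne\emptyset$, then $c_i=1+\max\{h_i:\mathbf{h}\in \operatorname{H}(S)\}$ for each $i$.) $\mathcal{F}(\mathbf{c})$ is the set of all GNSs in $\mathbb{N}_0^d$ with corner element $\mathbf{c}$. An element $S\in\mathcal{F}(\mathbf{c})$ is an atom if it cannot be written as an intersection of two GNSs in $\mathcal{F}(\mathbf{c})$ both properly containing $S$. $\operatorname{PF}(S)=\{\mathbf{x}\in \operatorname{H}(S): \mathbf{x}+S^*\subseteq S\}$ and the set of special gaps is $\operatorname{EH}(S)=\{\mathbf{x}\in\operatorname{PF}(S):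 2\mathbf{x}\in S\}$ (for $\mathbf h\in \operatorname{H}(S)$, $S\cup\{\mathbf{h}\}$ is a GNS iff $\mathbf{h}\in\operatorname{EH}(S)$). The set of corner special gaps $\operatorname{CEH}(S)$ is the set of $\mathbf{h}\in\operatorname{EH}(S)$ such that $S\cup\{\mathbf{h}\}$ has the same corner element as $S$. *)

theory Defs
  imports "HOL-Analysis.Cartesian_Space"
begin

text \<open>The monoid of \<open>d\<close>-tuples of non-negative integers is \<^typ>\<open>nat ^ 'd\<close> with \<open>d = CARD('d)\<close>,
  which is at least 1 because types are nonempty.\<close>

definition gns :: "(nat ^ 'd) set \<Rightarrow> bool" where
  "gns S \<longleftrightarrow> 0 \<in> S \<and> (\<forall>x\<in>S. \<forall>y\<in>S. x + y \<in> S) \<and> finite (- S)"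

definition gaps :: "(nat ^ 'd) set \<Rightarrow> (nat ^ 'd) set" where
  "gaps S = - S"

text \<open>If \<open>c $ i = 0\<close>, the second condition of a corner element asks for a vector with \<open>i\<close>-th
  coordinate \<open>-1\<close> outside \<open>S\<close>; this holds trivially, as such a vector is not in the ambient monoid.
  Since subtraction on \<^typ>\<open>nat\<close> truncates, this case is exempted explicitly. In particular the
  corner element of \<^term>\<open>UNIV\<close> is \<open>0\<close>.\<close>

definition is_corner_element :: "(nat ^ 'd) set \<Rightarrow> nat ^ 'd \<Rightarrow> bool" where
  "is_corner_element S c \<longleftrightarrow>
     c \<in> S \<and>
     (\<forall>i z. z $ i \<ge> c $ i \<longrightarrow> z \<in> S) \<and>
     (\<forall>i. c $ i > 0 \<longrightarrow> (\<exists>z. z $ i = c $ i - 1 \<and> z \<notin> S))"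

definition corner_element :: "(nat ^ 'd) set \<Rightarrow> nat ^ 'd" where
  "corner_element S = (THE c. is_corner_element S c)"

lemma is_corner_element_unique:
  assumes "is_corner_element S c" and "is_corner_element S c'"
  shows "c = c'"
proof -
  have le: "a $ i \<le> b $ i" if "is_corner_element S a" "is_corner_element S b" for a b i
  proof (rule ccontr)
    assume "\<not> a $ i \<le> b $ i"
    then have "a $ i > 0" "b $ i \<le> a $ i - 1" by auto
    with that show False unfolding is_corner_element_def by metis
  qed
  show ?thesis by (simp add: vec_eq_iff le assms antisym)
qed

lemma ex1_corner_element:
  fixes S :: "(nat ^ 'd) set"
  assumes "gns S"
  shows "\<exists>!c. is_corner_element S c"
proof -
  define P where "P i n \<longleftrightarrow> (\<forall>z. z $ i \<ge> n \<longrightarrow> z \<in> S)" for i :: 'd and n :: nat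
  have fin: "finite (- S)" using assms by (simp add: gns_def)
  have ex: "P i (Suc (\<Sum>z\<in>- S. z $ i))" for i
    unfolding P_def
  proof (intro allI impI, rule ccontr)
    fix z assume z: "Suc (\<Sum>z\<in>- S. z $ i) \<le> z $ i" "z \<notin> S"
    then have "z $ i \<le> (\<Sum>z\<in>- S. z $ i)"
      using fin by (intro member_le_sum) auto
    with z show False by simp
  qed
  define c :: "nat ^ 'd" where "c = (\<chi> i. LEAST n. P i n)"
  have ci: "P i (c $ i)" for i unfolding c_def using LeastI[of "P i", OF ex] by simp
  have "\<exists>z. z $ i = c $ i - 1 \<and> z \<notin> S" if "c $ i > 0" for i
  proof -
    have "\<not> P i (c $ i - 1)"
      using that not_less_Least[of "c $ i - 1" "P i"] by (simp add: c_def)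
    then obtain z where z: "z $ i \<ge> c $ i - 1" "z \<notin> S" by (auto simp: P_def)
    moreover have "z $ i < c $ i" using ci[of i] z by (auto simp: P_def not_le[symmetric])
    ultimately show ?thesis by (intro exI[of _ z]) auto
  qed
  with ci have "is_corner_element S c" unfolding is_corner_element_def P_def by blast
  then show ?thesis using is_corner_element_unique by blast
qed

lemma is_corner_element_corner_element:
  "gns S \<Longrightarrow> is_corner_element S (corner_element S)"
  unfolding corner_element_def by (rule theI') (rule ex1_corner_element)

definition gns_with_corner :: "nat ^ 'd \<Rightarrow> (nat ^ 'd) set set" where
  "gns_with_corner c = {S. gns S \<and> corner_element S = c}"

definition atom :: "nat ^ 'd \<Rightarrow> (nat ^ 'd) set \<Rightarrow> bool" where
  "atom c S \<longleftrightarrow> S \<in> gns_with_corner c \<and>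
     \<not> (\<exists>T\<in>gns_with_corner c. \<exists>U\<in>gns_with_corner c. S \<subset> T \<and> S \<subset> U \<and> S = T \<inter> U)"

definition PF :: "(nat ^ 'd) set \<Rightarrow> (nat ^ 'd) set" where
  "PF S = {x \<in> gaps S. \<forall>s\<in>S - {0}. x + s \<in> S}"

definition EH :: "(nat ^ 'd) set \<Rightarrow> (nat ^ 'd) set" where
  "EH S = {x \<in> PF S. 2 *s x \<in> S}"

text \<open>For \<^term>\<open>h \<in> EH S\<close> the set \<^term>\<open>S \<union> {h}\<close> is again a generalized numerical semigroup,
  so its corner element is well defined.\<close>

definition CEH :: "(nat ^ 'd) set \<Rightarrow> (nat ^ 'd) set" where
  "CEH S = {h \<in> EH S. corner_element (S \<union> {h}) = corner_element S}"

end

theory Submission imports Defs begin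

text \<open>Adjoining a special gap to \<open>S\<close> gives a generalized numerical semigroup, so two distinct corner
  special gaps \<open>h\<close>, \<open>k\<close> decompose \<open>S\<close> as \<open>(S \<union> {h}) \<inter> (S \<union> {k})\<close>. Conversely, if \<open>S \<subset> T\<close> have
  the same corner element, then an element of \<open>T - S\<close> with maximal coordinate sum is a corner
  special gap of \<open>S\<close>, because adding a nonzero element of \<open>T\<close> to it increases the coordinate sum.
  A decomposition \<open>S = T \<inter> U\<close> thus yields two of them, which are distinct since \<open>T - S\<close> and
  \<open>U - S\<close> are disjoint.\<close>

lemma corner_element_eqI:
  assumes "is_corner_element S c"
  shows "corner_element S = c"
  unfolding corner_element_def using assms by (blast intro: is_corner_element_unique)

text \<open>Membership in \<open>R\<close> is inherited from \<open>S\<close>, and a vector outside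
  \<open>T\<close> with \<open>i\<close>-th coordinate \<open>c $ i - 1\<close> is also outside
  \<open>R\<close>.\<close>

lemma is_corner_element_between:
  assumes "is_corner_element S c" "is_corner_element T c" "S \<subseteq> R" "R \<subseteq> T"
  shows "is_corner_element R c"
  using assms unfolding is_corner_element_def by (meson subsetD)

text \<open>Among the new sums, \<open>h + s\<close> with nonzero \<open>s\<close> in
  \<open>S\<close> is in \<open>S\<close> by \<open>PF\<close>, \<open>h + 0\<close> is
  \<open>h\<close>, and \<open>h + h\<close> is in \<open>S\<close> by the doubling condition of
  \<open>EH\<close>.\<close>

lemma gns_insert_EH:
  assumes S: "gns S" and h: "h \<in> EH S"
  shows "gns (insert h S)"
proof -
  have hs: "h + s \<in> insert h S" if "s \<in> S" for s
    using h that by (cases "s = 0") (auto simp: EH_def PF_def)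
  have "2 *s h = h + h" by (simp add: vec_eq_iff)
  then have hh: "h + h \<in> S" using h by (simp add: EH_def)
  have "x + y \<in> insert h S" if "x \<in> insert h S" "y \<in> insert h S" for x y
    using that hs hh S unfolding gns_def by (metis add.commute insert_iff)
  moreover have "finite (- insert h S)"
    using S by (auto simp: gns_def intro: finite_subset[rotated])
  ultimately show ?thesis using S by (simp add: gns_def)
qed

text \<open>Since \<open>card\<close> is 0 on infinite sets, \<open>card (CEH S) \<le> 1\<close>
  limits the number of elements only together with finiteness.\<close>

lemma finite_CEH:
  assumes "gns S"
  shows "finite (CEH S)"
  using assms by (auto simp: gns_def CEH_def EH_def PF_def gaps_def intro: finite_subset[rotated])

lemma CEH_meets_gns_with_corner_Diff:
  assumes S: "S \<in> gns_with_corner c" and T: "T \<in> gns_with_corner c" and "S \<subset> T"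
  obtains h where "h \<in> CEH S" "h \<in> T - S"
proof -
  have gS: "gns S" and gT: "gns T" using S T by (auto simp: gns_with_corner_def)
  define w :: "nat ^ 'a \<Rightarrow> nat" where "w x = (\<Sum>i\<in>UNIV. x $ i)" for x
  have w_add: "w x < w (x + y)" if "y \<noteq> 0" for x y
    using that by (auto simp: w_def sum.distrib vec_eq_iff intro: sum_pos2)
  have fin: "finite (T - S)"
    using gS by (auto simp: gns_def intro: finite_subset[rotated])
  then obtain h where h: "h \<in> T - S" and max: "\<And>x. x \<in> T - S \<Longrightarrow> w x \<le> w h"
    using \<open>S \<subset> T\<close> Max_in[of "w ` (T - S)"] Max_ge[of "w ` (T - S)"]
    by (smt (verit) Diff_eq_empty_iff finite_imageI imageE image_eqI image_is_empty psubsetE)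
  \<comment> \<open>Ranging over \<open>T\<close> and not only \<open>S\<close>, this also covers
    \<open>t = h\<close>, which gives the doubling condition of \<open>EH\<close>.\<close>
  have add: "h + t \<in> S" if "t \<in> T" "t \<noteq> 0" for t
  proof (rule ccontr)
    assume "h + t \<notin> S"
    moreover have "h + t \<in> T" using h that gT by (auto simp: gns_def)
    ultimately show False using max[of "h + t"] w_add[OF that(2), of h] by simp
  qed
  have "h \<noteq> 0" using h gS by (auto simp: gns_def)
  then have "h + h \<in> S" using h add by blast
  moreover have "2 *s h = h + h" by (simp add: vec_eq_iff)
  ultimately have "h \<in> EH S"
    using h add \<open>S \<subset> T\<close> by (auto simp: EH_def PF_def gaps_def)
  moreover have "is_corner_element S c" "is_corner_element T c"
    using S T is_corner_element_corner_element[OF gS] is_corner_element_corner_element[OF gT]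
    by (simp_all add: gns_with_corner_def)
  then have "is_corner_element (S \<union> {h}) c"
    by (rule is_corner_element_between) (use h \<open>S \<subset> T\<close> in auto)
  then have "corner_element (S \<union> {h}) = corner_element S"
    using S corner_element_eqI by (auto simp: gns_with_corner_def)
  ultimately have "h \<in> CEH S" by (simp add: CEH_def)
  with h that show thesis by blast
qed

theorem theorem4p4:
  fixes S :: "(nat ^ 'd) set" and c :: "nat ^ 'd"
  assumes "gns S" and "corner_element S = c"
  shows "atom c S \<longleftrightarrow> card (CEH S) \<le> 1"
proof
  assume atom: "atom c S"
  have "h = k" if h: "h \<in> CEH S" and k: "k \<in> CEH S" for h k
  proof (rule ccontr)
    assume "h \<noteq> k"
    \<comment> \<open>The inclusion is strict because \<open>x\<close> is a gap; the corner element
      is kept by the definition of \<open>CEH\<close>.\<close>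
    have ins: "insert x S \<in> gns_with_corner c \<and> S \<subset> insert x S" if "x \<in> CEH S" for x
      using that assms gns_insert_EH[of S x]
      by (auto simp: gns_with_corner_def CEH_def EH_def PF_def gaps_def)
    have "S = insert h S \<inter> insert k S" using \<open>h \<noteq> k\<close> by auto
    then show False using ins[OF h] ins[OF k] atom unfolding atom_def by blast
  qed
  then show "card (CEH S) \<le> 1"
    using finite_CEH[OF assms(1)] by (simp add: card_le_Suc0_iff_eq)
next
  assume card: "card (CEH S) \<le> 1"
  have S: "S \<in> gns_with_corner c" using assms by (simp add: gns_with_corner_def)
  have False
    if TU: "T \<in> gns_with_corner c" "U \<in> gns_with_corner c" "S \<subset> T" "S \<subset> U" "S = T \<inter> U" for T U
  proof -
    obtain h where h: "h \<in> CEH S" "h \<in> T - S"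
      by (rule CEH_meets_gns_with_corner_Diff[OF S TU(1,3)])
    obtain k where k: "k \<in> CEH S" "k \<in> U - S"
      by (rule CEH_meets_gns_with_corner_Diff[OF S TU(2,4)])
    have "h = k"
      using h k card finite_CEH[OF assms(1)] by (auto simp: card_le_Suc0_iff_eq)
    with h k \<open>S = T \<inter> U\<close> show False by blast
  qed
  with S show "atom c S" unfolding atom_def by blast
qed

end
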